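(* Let $X$ be a real Hilbert space and let $f\colon X\to\mathbb{R}$ be convex and continuous with $\{x\in X : f(x)\le 0\}\neq\varnothing$. Suppose that $f$ has the decreasing property. Then the following hold: (i) If $\alpha>0$, then $\alpha f$ has the decreasing property. (ii) If $\alpha\ge1$, then $(f^+)^\alpha$ has the decreasing property, where $f^+=\max\{f,0\}$.
   Context: For a convex continuous $h\colon X\to\mathbb{R}$ with $\{h\le0\}\neq\varnothing$ and a selection $s$ of the convex subdifferential $\partial h$ (i.e., $s(x)\in\partial h(x)$ for all $x$), set $G_{h,s}(x)=x-\frac{h(x)}{\|s(x)\|^2}s(x)$ if $h(x)>0$, and $G_{h,s}(x)=x$ otherwise, and set $\mathcal{G}_h(x)=\{G_{h,s}(x): s\text{ is a selection of }\partial h\}$. The function $h$ has the decreasing property if $\sup h(\mathcal{G}_h(x))\le h(x)$ for all $x\in X$. *)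

theory Defs
  imports "HOL-Analysis.Analysis"
begin

text \<open>A real Hilbert space is a type of sort \<open>{real_inner, complete_space}\<close>.\<close>

definition subdifferential :: "('a::real_inner \<Rightarrow> real) \<Rightarrow> 'a \<Rightarrow> 'a set" where
  "subdifferential h x = {u. \<forall>y. h x + inner u (y - x) \<le> h y}"

definition is_selection :: "('a \<Rightarrow> 'b set) \<Rightarrow> ('a \<Rightarrow> 'b) \<Rightarrow> bool" where
  "is_selection F s \<longleftrightarrow> (\<forall>x. s x \<in> F x)"

text \<open>If \<open>{x. h x \<le> 0} \<noteq> {}\<close> and \<open>h x > 0\<close> then \<open>x\<close> does not minimise \<open>h\<close>, so
  \<open>s x \<noteq> 0\<close> for every selection \<open>s\<close> and the quotient is a genuine one.\<close>

definition subgrad_proj :: "('a::real_inner \<Rightarrow> real) \<Rightarrow> ('a \<Rightarrow> 'a) \<Rightarrow> 'a \<Rightarrow> 'a" where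
  "subgrad_proj h s x =
     (if h x > 0 then x - (h x / (norm (s x))\<^sup>2) *\<^sub>R s x else x)"

definition subgrad_proj_set :: "('a::real_inner \<Rightarrow> real) \<Rightarrow> 'a \<Rightarrow> 'a set" where
  "subgrad_proj_set h x = {subgrad_proj h s x | s. is_selection (subdifferential h) s}"

text \<open>The decreasing property is only a notion for convex continuous functions with a nonempty
  zero-sublevel set, so these requirements are part of the predicate. The supremum is taken in
  the extended reals, because the set of values is not known in advance to be bounded above.\<close>

definition decreasing_property :: "('a::real_inner \<Rightarrow> real) \<Rightarrow> bool" where
  "decreasing_property h \<longleftrightarrow>
     convex_on UNIV h \<and> continuous_on UNIV h \<and> {x. h x \<le> 0} \<noteq> {} \<and>
     (\<forall>x. (SUP y \<in> subgrad_proj_set h x. ereal (h y)) \<le> ereal (h x))"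

end

theory Submission
  imports Defs
begin

text \<open>
  A subgradient \<open>u\<close> of \<open>(f\<^sup>+)\<^sup>\<alpha>\<close> at a point \<open>x\<close> with \<open>f x > 0\<close> has the form
  \<open>\<alpha> (f x)\<^sup>\<alpha>\<^sup>-\<^sup>1 v\<close> with \<open>v \<in> \<partial>f x\<close>. Hence a subgradient step for \<open>(f\<^sup>+)\<^sup>\<alpha>\<close> is the subgradient
  step for \<open>f\<close> relaxed by the factor \<open>1/\<alpha> \<le> 1\<close>, and convexity of \<open>f\<close> carries the decrease over.
  To see \<open>v\<close> as the value of a selection of \<open>\<partial>f\<close>, one needs \<open>\<partial>f \<noteq> {}\<close> everywhere. In a Hilbert
  space this follows by projecting points below the graph onto the epigraph, which yields
  \<open>\<epsilon>\<close>-subgradients; the sets of \<open>\<epsilon>\<close>-subgradients are closed, convex and bounded, so their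
  intersection as \<open>\<epsilon>\<close> decreases to 0 is nonempty.
\<close>

section \<open>Nested convex sets in Hilbert space\<close>

text \<open>Parallelogram identity with the midpoint \<open>w\<close>, which stays in
  \<open>S\<close>. It shows that points of a convex set with almost minimal norm lie close
  together.\<close>

lemma convex_norm_diff_le:
  fixes S :: "'a::real_inner set"
  assumes "convex S" and "u \<in> S" and "v \<in> S"
    and "(norm u)\<^sup>2 \<le> r" and "(norm v)\<^sup>2 \<le> r" and "\<And>w. w \<in> S \<Longrightarrow> b \<le> (norm w)\<^sup>2"
  shows "(norm (u - v))\<^sup>2 \<le> 4 * (r - b)"
proof -
  define w where "w = (1/2) *\<^sub>R u + (1/2) *\<^sub>R v"
  have "w \<in> S"
    using assms(1-3) by (simp add: convex_def w_def)
  then have "b \<le> (norm w)\<^sup>2"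
    by (rule assms(6))
  moreover have "(norm (u - v))\<^sup>2 = 2 * (norm u)\<^sup>2 + 2 * (norm v)\<^sup>2 - 4 * (norm w)\<^sup>2"
    unfolding power2_norm_eq_inner w_def
    by (simp add: inner_add_left inner_add_right inner_diff_left inner_diff_right
        inner_commute algebra_simps)
  ultimately show ?thesis
    using assms(4,5) by (simp add: algebra_simps)
qed

text \<open>Takes the place of weak compactness. The infima \<open>b n\<close> of the squared norm
  increase to a finite \<open>d\<close>, so the almost minimal slices \<open>S n\<close> shrink in
  diameter, and Cantor's intersection theorem gives a point common to all of them.\<close>

lemma bounded_closed_convex_nest:
  fixes C :: "nat \<Rightarrow> 'a::{real_inner, complete_space} set"
  assumes closed: "\<And>n. closed (C n)" and convex: "\<And>n. convex (C n)" and ne: "\<And>n. C n \<noteq> {}"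
    and nest: "\<And>m n. m \<le> n \<Longrightarrow> C n \<subseteq> C m" and bdd: "bounded (C 0)"
  obtains a where "\<And>n. a \<in> C n"
proof -
  define b where "b n = (INF u\<in>C n. (norm u)\<^sup>2)" for n
  define d where "d = (SUP n. b n)"
  define S where "S n = C n \<inter> {u. (norm u)\<^sup>2 \<le> d + inverse (real (Suc n))}" for n
  obtain B where B: "\<And>u. u \<in> C 0 \<Longrightarrow> norm u \<le> B"
    using bdd by (auto simp: bounded_iff)
  have bdd_sq: "bdd_below ((\<lambda>u. (norm u)\<^sup>2) ` C n)" for n
    by (rule bdd_belowI[of _ 0]) auto
  have b_le: "b n \<le> (norm u)\<^sup>2" if "u \<in> C n" for n u
    unfolding b_def by (rule cINF_lower[OF bdd_sq that])
  have b_bound: "b n \<le> B\<^sup>2" for n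
  proof -
    obtain u where u: "u \<in> C n"
      using ne by blast
    then have "norm u \<le> B"
      using B nest[of 0 n] by auto
    then show ?thesis
      using b_le[OF u] power_mono[of "norm u" B 2] by simp
  qed
  then have bdd_b: "bdd_above (range b)"
    by (intro bdd_aboveI[of _ "B\<^sup>2"]) auto
  have b_d: "b n \<le> d" for n
    unfolding d_def by (rule cSUP_upper[OF UNIV_I bdd_b])
  obtain a where "\<And>n. a \<in> S n"
  proof (rule decreasing_closed_nest[of S])
    fix n
    show "closed (S n)"
      unfolding S_def by (intro closed_Int closed closed_Collect_le continuous_intros)
    have "b n < d + inverse (real (Suc n))"
      using b_d[of n] by (smt (verit) inverse_positive_iff_positive of_nat_0_less_iff zero_less_Suc)
    then obtain u where "u \<in> C n" "(norm u)\<^sup>2 < d + inverse (real (Suc n))"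
      unfolding b_def cINF_less_iff[OF ne bdd_sq] by blast
    then show "S n \<noteq> {}"
      by (auto simp: S_def intro: less_imp_le)
  next
    fix m n :: nat
    assume mn: "m \<le> n"
    then have "inverse (real (Suc n)) \<le> inverse (real (Suc m))"
      by (intro le_imp_inverse_le) auto
    then show "S n \<subseteq> S m"
      unfolding S_def by (intro Int_mono nest[OF mn] Collect_mono impI) linarith
  next
    fix \<epsilon> :: real
    assume \<epsilon>: "\<epsilon> > 0"
    \<comment> \<open>Both \<open>d - b n1\<close> and the slack
      \<open>inverse (real (Suc n))\<close> are kept below this value, so four times their sum is
      below \<open>\<epsilon>\<^sup>2\<close>. The lower bound \<open>b n1\<close> remains valid on
      \<open>C n\<close> because \<open>n1 \<le> n\<close>.\<close>
    then have pos: "\<epsilon>\<^sup>2 / 8 > 0"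
      by simp
    then obtain n1 where n1: "d - \<epsilon>\<^sup>2 / 8 < b n1"
      using less_cSUP_iff[OF _ bdd_b, of "d - \<epsilon>\<^sup>2 / 8"] by (auto simp: d_def)
    obtain n2 where n2: "inverse (real (Suc n2)) < \<epsilon>\<^sup>2 / 8"
      using reals_Archimedean[OF pos] by blast
    define n where "n = max n1 n2"
    have "inverse (real (Suc n)) \<le> inverse (real (Suc n2))"
      by (intro le_imp_inverse_le) (auto simp: n_def)
    then have n2': "inverse (real (Suc n)) < \<epsilon>\<^sup>2 / 8"
      using n2 by linarith
    have "dist u v < \<epsilon>" if "u \<in> S n" "v \<in> S n" for u v
    proof -
      have "(norm (u - v))\<^sup>2 \<le> 4 * (d + inverse (real (Suc n)) - b n1)"
      proof (rule convex_norm_diff_le[OF convex[of n]])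
        fix w
        assume "w \<in> C n"
        then show "b n1 \<le> (norm w)\<^sup>2"
          using nest[of n1 n] b_le[of w n1] by (auto simp: n_def)
      qed (use that in \<open>auto simp: S_def\<close>)
      also have "\<dots> < \<epsilon>\<^sup>2"
        using n1 n2' by (simp add: algebra_simps)
      finally show ?thesis
        using \<epsilon> by (simp add: dist_norm power2_less_imp_less)
    qed
    then show "\<exists>n. \<forall>u\<in>S n. \<forall>v\<in>S n. dist u v < \<epsilon>"
      by blast
  qed (use that in blast)
  then show thesis
    using that by (auto simp: S_def)
qed

section \<open>Projection onto a closed convex set\<close>

text \<open>The slices of \<open>S\<close> by balls whose radii decrease to the infimum
  \<open>d\<close> of the norm are bounded, closed, convex and nested; a point common to them
  attains \<open>d\<close>.\<close>

lemma closed_convex_min_norm: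
  fixes S :: "'a::{real_inner, complete_space} set"
  assumes "closed S" and "convex S" and "S \<noteq> {}"
  obtains p where "p \<in> S" and "\<And>z. z \<in> S \<Longrightarrow> norm p \<le> norm z"
proof -
  define d where "d = (INF u\<in>S. norm u)"
  define C where "C n = S \<inter> cball 0 (d + inverse (real (Suc n)))" for n
  have bb: "bdd_below (norm ` S)"
    by (rule bdd_belowI[of _ 0]) auto
  obtain p where p: "\<And>n. p \<in> C n"
  proof (rule bounded_closed_convex_nest[of C])
    fix n
    show "closed (C n)" "convex (C n)"
      unfolding C_def using assms by (auto intro: closed_Int convex_Int)
    have "d < d + inverse (real (Suc n))"
      by simp
    then obtain u where "u \<in> S" "norm u < d + inverse (real (Suc n))"
      using cINF_less_iff[OF assms(3) bb] unfolding d_def by blast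
    then show "C n \<noteq> {}"
      by (auto simp: C_def intro: less_imp_le)
  next
    fix m n :: nat
    assume "m \<le> n"
    then have "inverse (real (Suc n)) \<le> inverse (real (Suc m))"
      by (intro le_imp_inverse_le) auto
    then show "C n \<subseteq> C m"
      unfolding C_def by (intro Int_mono order_refl subset_cball add_left_mono)
  next
    show "bounded (C 0)"
      unfolding C_def by (simp add: bounded_Int)
  qed (use that in blast)
  show thesis
  proof
    show "p \<in> S"
      using p[of 0] by (simp add: C_def)
    fix z
    assume "z \<in> S"
    then have "d \<le> norm z"
      unfolding d_def by (rule cINF_lower[OF bb])
    moreover have "norm p \<le> d"
    proof (rule field_le_epsilon)
      fix e :: real
      assume "e > 0"
      then obtain n where "inverse (real (Suc n)) < e"
        using reals_Archimedean by blast
      then show "norm p \<le> d + e"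
        using p[of n] by (simp add: C_def)
    qed
    ultimately show "norm p \<le> norm z"
      by simp
  qed
qed

text \<open>Translation by \<open>a\<close> turns the nearest point into one of least norm; the
  inequality is the variational characterisation of the nearest point.\<close>

lemma closed_convex_projection:
  fixes S :: "'a::{real_inner, complete_space} set"
  assumes "closed S" and "convex S" and "S \<noteq> {}"
  obtains p where "p \<in> S" and "\<And>z. z \<in> S \<Longrightarrow> inner (a - p) (z - p) \<le> 0"
proof -
  have "closed ((\<lambda>z. z - a) ` S)" "convex ((\<lambda>z. z - a) ` S)" "(\<lambda>z. z - a) ` S \<noteq> {}"
    using assms closed_translation_subtract convex_translation_subtract by auto
  then obtain q where q: "q \<in> (\<lambda>z. z - a) ` S" "\<And>z. z \<in> (\<lambda>z. z - a) ` S \<Longrightarrow> norm q \<le> norm z"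
    by (rule closed_convex_min_norm) blast
  then obtain p where p: "p \<in> S" "q = p - a"
    by blast
  have "\<forall>z\<in>S. dist a p \<le> dist a z"
    using q(2) p(2) by (auto simp: dist_norm norm_minus_commute)
  then show thesis
    using that[OF p(1)] any_closest_point_dot[OF assms(2,1) p(1)] by blast
qed

section \<open>Existence of subgradients\<close>

text \<open>Projecting \<open>(x, f x - \<epsilon>)\<close> onto the closed convex epigraph yields a
  hyperplane with normal \<open>(w, - a)\<close>. It is not vertical, and its slope
  \<open>w /\<^sub>R a\<close> is the vector sought.\<close>

lemma eps_subgradient_exists:
  fixes f :: "'a::{real_inner, complete_space} \<Rightarrow> real"
  assumes conv: "convex_on UNIV f" and cont: "continuous_on UNIV f" and "\<epsilon> > 0"
  obtains u where "\<And>y. f x + inner u (y - x) - \<epsilon> \<le> f y"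
proof -
  have eq: "epigraph UNIV f = {z. f (fst z) \<le> snd z}"
    by (auto simp: epigraph_def)
  have "closed (epigraph UNIV f)"
    unfolding eq
    by (intro closed_Collect_le continuous_on_compose2[OF cont] continuous_intros) auto
  moreover have "convex (epigraph UNIV f)"
    using conv by (rule convex_epigraphI)
  moreover have "epigraph UNIV f \<noteq> {}"
    by (auto simp: epigraph_def)
  ultimately obtain q where q: "q \<in> epigraph UNIV f"
    and qz: "\<And>z. z \<in> epigraph UNIV f \<Longrightarrow> inner ((x, f x - \<epsilon>) - q) (z - q) \<le> 0"
    by (rule closed_convex_projection) blast
  obtain p r where pr: "q = (p, r)"
    by (cases q)
  define w where "w = x - p"
  define a where "a = r - (f x - \<epsilon>)"
  have fp: "f p \<le> r"
    using q by (simp add: pr epigraph_def)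
  have ineq: "inner w (y - p) \<le> a * (t - r)" if "f y \<le> t" for y t
    using qz[of "(y, t)"] that
    by (simp add: pr epigraph_def w_def a_def algebra_simps)
  \<comment> \<open>Moving straight up from \<open>q\<close> stays in the epigraph, which fixes the
    sign of \<open>a\<close>.\<close>
  have "a \<ge> 0"
    using ineq[of p "r + 1"] fp by simp
  moreover have "a \<noteq> 0"
  \<comment> \<open>A vertical hyperplane would force \<open>p = x\<close> and
    \<open>r = f x - \<epsilon>\<close>, a point strictly below the graph.\<close>
  proof
    assume "a = 0"
    then have "inner w w \<le> 0"
      using ineq[of x "f x"] by (simp add: w_def)
    then have "w = 0"
      by (metis inner_gt_zero_iff not_less)
    then show False
      using fp \<open>a = 0\<close> \<open>\<epsilon> > 0\<close> by (simp add: w_def a_def)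
  qed
  ultimately have a: "a > 0"
    by simp
  show thesis
  proof
    fix y
    have "inner (w /\<^sub>R a) (y - p) \<le> f y - r"
      using ineq[of y "f y"] a by (simp add: field_simps)
    moreover have "inner (w /\<^sub>R a) (y - p) = inner (w /\<^sub>R a) (y - x) + inner w w / a"
      by (simp add: w_def inner_diff_left inner_diff_right divide_inverse algebra_simps)
    moreover have "inner w w / a \<ge> 0"
      using a by simp
    \<comment> \<open>Since \<open>r = f x - \<epsilon> + a\<close>, the bound results from dropping
      the nonnegative terms \<open>a\<close> and \<open>inner w w / a\<close>.\<close>
    ultimately show "f x + inner (w /\<^sub>R a) (y - x) - \<epsilon> \<le> f y"
      using a a_def by linarith
  qed
qed

text \<open>The sets \<open>C n\<close> of \<epsilon>-subgradients for
  \<open>\<epsilon> = inverse (real (Suc n))\<close> are intersections of closed halfspaces, and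
  continuity of \<open>f\<close> at \<open>x\<close> bounds the largest, \<open>C 0\<close>. A
  common element is a subgradient.\<close>

lemma subdifferential_nonempty:
  fixes f :: "'a::{real_inner, complete_space} \<Rightarrow> real"
  assumes conv: "convex_on UNIV f" and cont: "continuous_on UNIV f"
  shows "subdifferential f x \<noteq> {}"
proof -
  define C where "C n = {u. \<forall>y. f x + inner u (y - x) - inverse (real (Suc n)) \<le> f y}" for n
  obtain a where a: "\<And>n. a \<in> C n"
  proof (rule bounded_closed_convex_nest[of C])
    fix n
    have C_eq: "C n = (\<Inter>y. {u. inner (y - x) u \<le> f y - f x + inverse (real (Suc n))})"
      by (auto simp: C_def inner_commute algebra_simps)
    show "closed (C n)"
      unfolding C_eq by (intro closed_INT ballI closed_halfspace_le)
    show "convex (C n)"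
      unfolding C_eq by (intro convex_INT convex_halfspace_le)
    obtain u where "\<And>y. f x + inner u (y - x) - inverse (real (Suc n)) \<le> f y"
      by (rule eps_subgradient_exists[OF conv cont, of "inverse (real (Suc n))" x]) auto
    then show "C n \<noteq> {}"
      by (auto simp: C_def)
  next
    fix m n :: nat
    assume "m \<le> n"
    then have "inverse (real (Suc n)) \<le> inverse (real (Suc m))"
      by (intro le_imp_inverse_le) auto
    then show "C n \<subseteq> C m"
      by (auto simp: C_def intro: order_trans[rotated])
  next
    obtain \<delta> where \<delta>: "\<delta> > 0" "\<And>y. dist y x < \<delta> \<Longrightarrow> dist (f y) (f x) < 1"
      using cont unfolding continuous_on_iff by (metis UNIV_I zero_less_one)
    have "norm u \<le> 4 / \<delta>" if u: "u \<in> C 0" for u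
    proof (cases "u = 0")
      case False
      \<comment> \<open>A step of length \<open>\<delta> / 2\<close> along \<open>u\<close>: the
        inequality defining \<open>C 0\<close>, where \<epsilon> is 1, gives
        \<open>\<delta> * norm u / 2 - 1 < 1\<close>.\<close>
      define y where "y = x + (\<delta> / (2 * norm u)) *\<^sub>R u"
      have "dist y x < \<delta>"
        using \<delta>(1) False by (simp add: y_def dist_norm)
      then have "f y < f x + 1"
        using \<delta>(2)[of y] by (simp add: dist_real_def)
      moreover have "inner u (y - x) = \<delta> * norm u / 2"
        using False by (simp add: y_def dot_square_norm power2_eq_square)
      moreover have "f x + inner u (y - x) - 1 \<le> f y"
        using u by (simp add: C_def)
      ultimately have "\<delta> * norm u \<le> 4"
        by linarith
      then show ?thesis
        using \<delta>(1) by (simp add: field_simps)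
    qed (use \<delta>(1) in simp)
    then show "bounded (C 0)"
      by (auto simp: bounded_iff)
  qed (use that in blast)
  have "f x + inner a (y - x) \<le> f y" for y
  proof (rule field_le_epsilon)
    fix e :: real
    assume "e > 0"
    then obtain n where "inverse (real (Suc n)) < e"
      using reals_Archimedean by blast
    moreover have "f x + inner a (y - x) - inverse (real (Suc n)) \<le> f y"
      using a[of n] by (simp add: C_def)
    ultimately show "f x + inner a (y - x) \<le> f y + e"
      by linarith
  qed
  then show ?thesis
    by (auto simp: subdifferential_def)
qed

section \<open>From selections to single subgradients\<close>

text \<open>Only the value of a selection at \<open>x\<close> matters, and any subgradient at
  \<open>x\<close> extends to a selection by arbitrary choices elsewhere, because no subdifferential
  is empty.\<close>

lemma subgrad_proj_set_eq:
  fixes h :: "'a::{real_inner, complete_space} \<Rightarrow> real"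
  assumes "convex_on UNIV h" and "continuous_on UNIV h"
  shows "subgrad_proj_set h x =
    (\<lambda>u. if h x > 0 then x - (h x / (norm u)\<^sup>2) *\<^sub>R u else x) ` subdifferential h x"
proof (intro subset_antisym subsetI)
  fix z
  assume "z \<in> (\<lambda>u. if h x > 0 then x - (h x / (norm u)\<^sup>2) *\<^sub>R u else x) ` subdifferential h x"
  then obtain u where u: "u \<in> subdifferential h x"
    and z: "z = (if h x > 0 then x - (h x / (norm u)\<^sup>2) *\<^sub>R u else x)"
    by blast
  define s where "s = (\<lambda>y. SOME v. v \<in> subdifferential h y)(x := u)"
  have "is_selection (subdifferential h) s"
    using u subdifferential_nonempty[OF assms]
    by (auto simp: is_selection_def s_def some_in_eq)
  moreover have "z = subgrad_proj h s x"
    by (simp add: z subgrad_proj_def s_def)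
  ultimately show "z \<in> subgrad_proj_set h x"
    unfolding subgrad_proj_set_def by blast
qed (auto simp: subgrad_proj_set_def subgrad_proj_def is_selection_def)

lemma decreasing_property_iff:
  fixes h :: "'a::{real_inner, complete_space} \<Rightarrow> real"
  assumes "convex_on UNIV h" and "continuous_on UNIV h" and "{x. h x \<le> 0} \<noteq> {}"
  shows "decreasing_property h \<longleftrightarrow>
    (\<forall>x. \<forall>u\<in>subdifferential h x. h x > 0 \<longrightarrow> h (x - (h x / (norm u)\<^sup>2) *\<^sub>R u) \<le> h x)"
  using assms unfolding decreasing_property_def subgrad_proj_set_eq[OF assms(1,2)]
  by (auto simp: SUP_le_iff)

section \<open>Subgradients of multiples and powers\<close>

lemma subdifferential_cmult:
  fixes f :: "'a::real_inner \<Rightarrow> real"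
  assumes "\<alpha> > 0" and "u \<in> subdifferential (\<lambda>x. \<alpha> * f x) x"
  shows "u /\<^sub>R \<alpha> \<in> subdifferential f x"
  using assms by (simp add: subdifferential_def field_simps)

text \<open>Extends \<open>powr_convex\<close> to the endpoint 0, where the inequality reduces to
  \<open>t powr \<alpha> \<le> t\<close> for \<open>t\<close> between 0 and 1.\<close>

lemma convex_on_powr_nonneg:
  fixes \<alpha> :: real
  assumes "\<alpha> \<ge> 1"
  shows "convex_on {0..} (\<lambda>x. x powr \<alpha>)"
proof (rule convex_on_linorderI)
  fix t x y :: real
  assume t: "0 < t" "t < 1" and xy: "x \<in> {0..}" "y \<in> {0..}" "x < y"
  show "((1 - t) *\<^sub>R x + t *\<^sub>R y) powr \<alpha> \<le> (1 - t) * x powr \<alpha> + t * y powr \<alpha>"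
  proof (cases "x = 0")
    case True
    have "t powr \<alpha> \<le> t powr 1"
      using t assms by (intro powr_mono') auto
    then show ?thesis
      using True t xy assms by (simp add: powr_mult mult_right_mono)
  next
    case False
    then show ?thesis
      using convex_onD[OF powr_convex[OF assms], of t x y] t xy by auto
  qed
qed simp

lemma convex_on_pos_part_powr:
  fixes f :: "'a::real_vector \<Rightarrow> real"
  assumes conv: "convex_on UNIV f" and "\<alpha> \<ge> 1"
  shows "convex_on UNIV (\<lambda>x. max (f x) 0 powr \<alpha>)"
proof (rule convex_onI)
  fix t :: real and x y :: 'a
  assume t: "0 < t" "t < 1"
  have "f ((1 - t) *\<^sub>R x + t *\<^sub>R y) \<le> (1 - t) * f x + t * f y"
    using convex_onD[OF conv, of t x y] t by simp
  also have "\<dots> \<le> (1 - t) * max (f x) 0 + t * max (f y) 0"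
    using t by (intro add_mono mult_left_mono) auto
  finally have "max (f ((1 - t) *\<^sub>R x + t *\<^sub>R y)) 0 \<le> (1 - t) * max (f x) 0 + t * max (f y) 0"
    using t by simp
  then have "max (f ((1 - t) *\<^sub>R x + t *\<^sub>R y)) 0 powr \<alpha>
      \<le> ((1 - t) * max (f x) 0 + t * max (f y) 0) powr \<alpha>"
    using assms(2) by (intro powr_mono2) auto
  also have "\<dots> \<le> (1 - t) * max (f x) 0 powr \<alpha> + t * max (f y) 0 powr \<alpha>"
    using convex_onD[OF convex_on_powr_nonneg[OF assms(2)], of t "max (f x) 0" "max (f y) 0"] t
    by simp
  finally show "max (f ((1 - t) *\<^sub>R x + t *\<^sub>R y)) 0 powr \<alpha>
      \<le> (1 - t) * max (f x) 0 powr \<alpha> + t * max (f y) 0 powr \<alpha>" .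
qed simp

text \<open>A one-sided chain rule, with scaling factor the derivative of the power at
  \<open>f x\<close>. Along the segment from \<open>x\<close> to \<open>y\<close> the chord of
  \<open>f\<close> lies above \<open>f\<close>, so the difference quotients of \<phi> dominate
  \<open>inner u (y - x)\<close>, and so does their limit \<open>c * m\<close>.\<close>

lemma subdifferential_pos_part_powr:
  fixes f :: "'a::real_inner \<Rightarrow> real"
  assumes conv: "convex_on UNIV f" and "\<alpha> > 0" and fx: "f x > 0"
    and u: "u \<in> subdifferential (\<lambda>x. max (f x) 0 powr \<alpha>) x"
  shows "u /\<^sub>R (\<alpha> * f x powr (\<alpha> - 1)) \<in> subdifferential f x"
proof -
  define c where "c = \<alpha> * f x powr (\<alpha> - 1)"
  have c: "c > 0"
    using assms by (simp add: c_def)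
  have "f x + inner (u /\<^sub>R c) (y - x) \<le> f y" for y
  proof -
    define m where "m = f y - f x"
    define \<phi> where "\<phi> t = (f x + t * m) powr \<alpha>" for t
    have "(\<phi> has_real_derivative c * m) (at 0)"
      unfolding \<phi>_def c_def using fx by (auto intro!: derivative_eq_intros)
    then have "((\<lambda>t. (\<phi> t - \<phi> 0) / t) \<longlongrightarrow> c * m) (at 0)"
      by (simp add: DERIV_def)
    then have lim: "((\<lambda>t. (\<phi> t - \<phi> 0) / t) \<longlongrightarrow> c * m) (at_right 0)"
      by (rule filterlim_mono) (auto simp: at_le)
    \<comment> \<open>For small \<open>t\<close> the chord is positive even if \<open>f y\<close> is
      negative, so it also bounds the positive part of \<open>f z\<close>.\<close>
    have "((\<lambda>t. f x + t * m) \<longlongrightarrow> f x + 0 * m) (at_right 0)"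
      by (intro tendsto_intros)
    then have ev_pos: "\<forall>\<^sub>F t in at_right 0. f x + t * m > 0"
      using fx by (intro order_tendstoD(1)) auto
    have ev_1: "\<forall>\<^sub>F t in at_right (0::real). 0 < t \<and> t < 1"
      using eventually_at_right_real[of 0 1] by (auto elim: eventually_mono)
    have "\<forall>\<^sub>F t in at_right 0. inner u (y - x) \<le> (\<phi> t - \<phi> 0) / t"
      using ev_pos ev_1
    proof eventually_elim
      case (elim t)
      define z where "z = (1 - t) *\<^sub>R x + t *\<^sub>R y"
      have "f z \<le> f x + t * m"
        using convex_onD[OF conv, of t x y] elim by (simp add: z_def m_def algebra_simps)
      then have "max (f z) 0 powr \<alpha> \<le> \<phi> t"
        unfolding \<phi>_def using elim \<open>\<alpha> > 0\<close> by (intro powr_mono2) auto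
      moreover have "f x powr \<alpha> + inner u (z - x) \<le> max (f z) 0 powr \<alpha>"
        using u fx unfolding subdifferential_def by (auto simp: max_def dest!: spec[of _ z])
      moreover have "z - x = t *\<^sub>R (y - x)"
        by (simp add: z_def algebra_simps)
      ultimately have "t * inner u (y - x) \<le> \<phi> t - \<phi> 0"
        by (simp add: \<phi>_def)
      then show ?case
        using elim by (simp add: field_simps)
    qed
    then have "inner u (y - x) \<le> c * m"
      by (rule tendsto_lowerbound[OF lim]) simp
    then show ?thesis
      using c by (simp add: m_def field_simps)
  qed
  then show ?thesis
    by (simp add: subdifferential_def c_def)
qed

section \<open>Transfer of the decreasing property\<close>

text \<open>The subgradient step is invariant under scaling: \<open>u\<close> for
  \<open>\<alpha> * f\<close> and \<open>u /\<^sub>R \<alpha>\<close> for \<open>f\<close> lead to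
  the same point.\<close>

lemma decreasing_property_cmult:
  fixes f :: "'a::{real_inner, complete_space} \<Rightarrow> real"
  assumes f: "convex_on UNIV f" "continuous_on UNIV f" "{x. f x \<le> 0} \<noteq> {}"
    and dec: "decreasing_property f" and \<alpha>: "\<alpha> > 0"
  shows "decreasing_property (\<lambda>x. \<alpha> * f x)"
proof (subst decreasing_property_iff)
  show "convex_on UNIV (\<lambda>x. \<alpha> * f x)"
    using f(1) \<alpha> by (intro convex_on_cmul) auto
  show "continuous_on UNIV (\<lambda>x. \<alpha> * f x)"
    by (intro continuous_intros f(2))
  show "{x. \<alpha> * f x \<le> 0} \<noteq> {}"
    using f(3) \<alpha> by (auto simp: mult_le_0_iff)
  show "\<forall>x. \<forall>u\<in>subdifferential (\<lambda>x. \<alpha> * f x) x. \<alpha> * f x > 0 \<longrightarrow>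
      \<alpha> * f (x - (\<alpha> * f x / (norm u)\<^sup>2) *\<^sub>R u) \<le> \<alpha> * f x"
  proof (intro allI ballI impI)
    fix x u
    assume u: "u \<in> subdifferential (\<lambda>x. \<alpha> * f x) x" and "\<alpha> * f x > 0"
    then have fx: "f x > 0"
      using \<alpha> by (simp add: zero_less_mult_iff)
    have "f (x - (f x / (norm (u /\<^sub>R \<alpha>))\<^sup>2) *\<^sub>R (u /\<^sub>R \<alpha>)) \<le> f x"
      using dec fx subdifferential_cmult[OF \<alpha> u] unfolding decreasing_property_iff[OF f] by blast
    moreover have "f x / (norm (u /\<^sub>R \<alpha>))\<^sup>2 * inverse \<alpha> = \<alpha> * f x / (norm u)\<^sup>2"
      using \<alpha> by (simp add: power2_eq_square divide_inverse)
    ultimately show "\<alpha> * f (x - (\<alpha> * f x / (norm u)\<^sup>2) *\<^sub>R u) \<le> \<alpha> * f x"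
      using \<alpha> by simp
  qed
qed

lemma decreasing_property_pos_part_powr:
  fixes f :: "'a::{real_inner, complete_space} \<Rightarrow> real"
  assumes f: "convex_on UNIV f" "continuous_on UNIV f" "{x. f x \<le> 0} \<noteq> {}"
    and dec: "decreasing_property f" and \<alpha>: "\<alpha> \<ge> 1"
  shows "decreasing_property (\<lambda>x. max (f x) 0 powr \<alpha>)"
proof (subst decreasing_property_iff)
  show "convex_on UNIV (\<lambda>x. max (f x) 0 powr \<alpha>)"
    using f(1) \<alpha> by (rule convex_on_pos_part_powr)
  show "continuous_on UNIV (\<lambda>x. max (f x) 0 powr \<alpha>)"
    using \<alpha> by (intro continuous_on_powr' continuous_intros f(2)) auto
  show "{x. max (f x) 0 powr \<alpha> \<le> 0} \<noteq> {}"
    using f(3) by (auto simp: max_def)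
  show "\<forall>x. \<forall>u\<in>subdifferential (\<lambda>x. max (f x) 0 powr \<alpha>) x. max (f x) 0 powr \<alpha> > 0 \<longrightarrow>
      max (f (x - (max (f x) 0 powr \<alpha> / (norm u)\<^sup>2) *\<^sub>R u)) 0 powr \<alpha> \<le> max (f x) 0 powr \<alpha>"
  proof (intro allI ballI impI)
    fix x u
    assume u: "u \<in> subdifferential (\<lambda>x. max (f x) 0 powr \<alpha>) x"
      and "max (f x) 0 powr \<alpha> > 0"
    \<comment> \<open>Uses \<open>0 powr \<alpha> = 0\<close>.\<close>
    then have fx: "f x > 0"
      by (auto simp: max_def split: if_splits)
    define c where "c = \<alpha> * f x powr (\<alpha> - 1)"
    define v where "v = u /\<^sub>R c"
    define y where "y = x - (f x / (norm v)\<^sup>2) *\<^sub>R v"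
    have c: "c > 0"
      using fx \<alpha> by (simp add: c_def)
    have v: "v \<in> subdifferential f x"
      unfolding v_def c_def using subdifferential_pos_part_powr[OF f(1) _ fx u] \<alpha> by simp
    then have fy: "f y \<le> f x"
      using dec fx unfolding decreasing_property_iff[OF f] y_def by blast
    have "f x powr \<alpha> = c * f x / \<alpha>"
      using fx \<alpha> by (simp add: c_def powr_diff)
    moreover have "u = c *\<^sub>R v"
      using c by (simp add: v_def)
    \<comment> \<open>The two factors \<open>c\<close>, from the function value and from
      \<open>u\<close>, cancel against the squared norm of \<open>u\<close>; only the relaxation
      \<open>1 / \<alpha>\<close> is left.\<close>
    ultimately have "(f x powr \<alpha> / (norm u)\<^sup>2) *\<^sub>R u = (1 / \<alpha>) *\<^sub>R (f x / (norm v)\<^sup>2) *\<^sub>R v"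
      using c by (simp add: power2_eq_square)
    then have step: "x - (f x powr \<alpha> / (norm u)\<^sup>2) *\<^sub>R u = (1 - 1 / \<alpha>) *\<^sub>R x + (1 / \<alpha>) *\<^sub>R y"
      by (simp add: y_def algebra_simps)
    have "f ((1 - 1 / \<alpha>) *\<^sub>R x + (1 / \<alpha>) *\<^sub>R y) \<le> (1 - 1 / \<alpha>) * f x + (1 / \<alpha>) * f y"
      using convex_onD[OF f(1), of "1 / \<alpha>" x y] \<alpha> by simp
    also have "\<dots> \<le> (1 - 1 / \<alpha>) * f x + (1 / \<alpha>) * f x"
      using fy \<alpha> by (intro add_mono mult_left_mono) auto
    also have "\<dots> = f x"
      by (simp add: algebra_simps)
    finally have "f (x - (f x powr \<alpha> / (norm u)\<^sup>2) *\<^sub>R u) \<le> f x"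
      by (simp only: step)
    then show "max (f (x - (max (f x) 0 powr \<alpha> / (norm u)\<^sup>2) *\<^sub>R u)) 0 powr \<alpha>
        \<le> max (f x) 0 powr \<alpha>"
      using fx \<alpha> by (intro powr_mono2) (auto simp: max_def)
  qed
qed

theorem proposition9p8:
  fixes f :: "'a::{real_inner, complete_space} \<Rightarrow> real"
  assumes "convex_on UNIV f"
    and "continuous_on UNIV f"
    and "{x. f x \<le> 0} \<noteq> {}"
    and "decreasing_property f"
  shows "(\<forall>\<alpha>::real. \<alpha> > 0 \<longrightarrow> decreasing_property (\<lambda>x. \<alpha> * f x)) \<and>
         (\<forall>\<alpha>::real. \<alpha> \<ge> 1 \<longrightarrow> decreasing_property (\<lambda>x. (max (f x) 0) powr \<alpha>))"
  using decreasing_property_cmult[OF assms] decreasing_property_pos_part_powr[OF assms] by blast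

end
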